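(* Let $n\in\mathbb{N}$, $s,k\in\mathbb{Z}$ and let $f=f_n$ be an even function (mod $n$). Assume that $\nu_p(n)\ge \nu_p(k)+2$ for every prime $p\mid n$. Then $$S_f(n,k,s) = e(ks/n) \sum_{\substack{d\mid (n,k)\\ (n/d,s)=1}} d\,(\mu*f_n)(n/d).$$
   Context: $\mathbb{N}=\{1,2,\ldots\}$; $(a,b)$ is the greatest common divisor of $a,b\in\mathbb{Z}$; $\mu$ is the Möbius function; $e(x)=e^{2\pi i x}$ for $x\in\mathbb{R}$; $\nu_p(n)$ is the exponent of the prime $p$ in the prime factorization of $n\in\mathbb{Z}$, with the convention $\nu_p(0)=\infty$. All divisors in sums are positive. For fixed $n\in\mathbb{N}$, a function $f_n:\mathbb{Z}\to\mathbb{C}$ is an even function (mod $n$) if $f_n((a,n))=f_n(a)$ for every $a\in\mathbb{Z}$. For $d\in\mathbb{N}$, $(\mu*f_n)(d)=\sum_{ab=d,\ a,b\in\mathbb{N}}\mu(a)f_n(b)$ (Dirichlet convolution, with $f_n$ restricted to $\mathbb{N}$). For $f=f_n$ even (mod $n$) and $k,s\in\mathbb{Z}$, $$S_f(n,k,s):=\sum_{\substack{a=1\\ (a,n)=1}}^n f_n(a-s)\, e(ak/n).$$ *)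

theory Defs
  imports
    Complex_Main
    "HOL-Computational_Algebra.Computational_Algebra"
    "HOL-Library.Extended_Nat"
begin

definition moebius_mu :: "nat \<Rightarrow> int" where
  "moebius_mu n = (if squarefree n then (-1) ^ card (prime_factors n) else 0)"

definition dirichlet_conv :: "(nat \<Rightarrow> complex) \<Rightarrow> (nat \<Rightarrow> complex) \<Rightarrow> nat \<Rightarrow> complex" where
  "dirichlet_conv g h d = (\<Sum>(a, b) | 0 < a \<and> 0 < b \<and> a * b = d. g a * h b)"

text \<open>The exponential \<open>e(x) = exp (2 \<pi> i x)\<close>.\<close>

definition unit_exp :: "real \<Rightarrow> complex" where
  "unit_exp x = exp (2 * of_real pi * \<i> * of_real x)"

text \<open>
  The library function \<^const>\<open>multiplicity\<close> yields \<open>0\<close> at \<open>0\<close>, whereas the \<open>p\<close>-adic valuation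
  of \<open>0\<close> is infinite.
\<close>

definition padic_val :: "nat \<Rightarrow> int \<Rightarrow> enat" where
  "padic_val p m = (if m = 0 then \<infinity> else enat (multiplicity (int p) m))"

definition even_function_mod :: "nat \<Rightarrow> (int \<Rightarrow> complex) \<Rightarrow> bool" where
  "even_function_mod n f \<longleftrightarrow> (\<forall>a. f (gcd a (int n)) = f a)"

definition S_sum :: "(int \<Rightarrow> complex) \<Rightarrow> nat \<Rightarrow> int \<Rightarrow> int \<Rightarrow> complex" where
  "S_sum f n k s =
     (\<Sum>a | a \<in> {1..int n} \<and> gcd a (int n) = 1.
        f (a - s) * unit_exp (real_of_int (a * k) / real n))"

end

theory Submission
  imports Defs
begin

text \<open>
  Moebius inversion writes \<open>f (a - s)\<close> as the sum of \<open>(\<mu> * f) d\<close> over the common divisors \<open>d\<close> of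
  \<open>a - s\<close> and \<open>n\<close>. Exchanging the summations leaves, for every \<open>d\<close> dividing \<open>n\<close>, the exponential
  sum over the reduced residues \<open>a\<close> modulo \<open>n\<close> in the class of \<open>s\<close> modulo \<open>d\<close>
  (lemma \<open>S_sum_eq_sum_over_divisors\<close>). This sum has a closed form:

  \<^item> If \<open>d\<close> and \<open>s\<close> have a common factor, no reduced residue lies in the class.

  \<^item> If \<open>n\<close> divides \<open>d * k\<close>, the summand is constant on the class. The hypothesis on valuations
    forces every prime factor of \<open>n\<close> to divide \<open>d\<close>, so being prime to \<open>n\<close> is the same as being
    prime to \<open>d\<close>, and all \<open>n / d\<close> elements of the class are counted
    (lemma \<open>unit_class_sum_constant\<close>).

  \<^item> Otherwise there is a prime \<open>p\<close> such that \<open>t = n / p ^ (\<nu>\<^sub>p(k) + 1)\<close> is a multiple of \<open>d\<close>. By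
    hypothesis \<open>t\<close> is still divisible by all primes dividing \<open>n\<close>. Hence translation by \<open>t\<close>
    permutes the range of summation, while it multiplies the sum by \<open>e(t k / n) \<noteq> 1\<close>; the sum
    vanishes (lemma \<open>unit_class_sum_vanishes\<close>).

  Renaming \<open>n / d\<close> to \<open>d\<close> in what remains gives the formula.
\<close>

section \<open>Moebius inversion\<close>

lemma moebius_mu_prime_mult:
  assumes "prime p" "\<not> p dvd d"
  shows "moebius_mu (p * d) = - moebius_mu d"
proof -
  have d: "d > 0"
    using assms(2) by (cases "d = 0") auto
  have cop: "coprime p d"
    using assms by (simp add: prime_imp_coprime)
  have "squarefree (p * d) \<longleftrightarrow> squarefree d"
    using cop assms(1) squarefree_mult_coprime squarefree_prime squarefree_multD(2) by blast
  moreover have "prime_factors (p * d) = insert p (prime_factors d)"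
    using assms(1) d by (simp add: prime_factors_product prime_prime_factors prime_gt_0_nat)
  moreover have "p \<notin> prime_factors d"
    using assms(2) by auto
  ultimately show ?thesis
    by (simp add: moebius_mu_def)
qed

text \<open>
  For a prime \<open>p\<close> dividing \<open>m\<close>, multiplication by \<open>p\<close> pairs the squarefree divisors of \<open>m\<close> prime
  to \<open>p\<close> with the ones divisible by \<open>p\<close>, and flips the sign.
\<close>

lemma sum_moebius_mu_divisors:
  assumes "m > 0"
  shows "(\<Sum>d | d dvd m. moebius_mu d) = (if m = 1 then 1 else 0)"
proof (cases "m = 1")
  case True
  then show ?thesis
    by (simp add: moebius_mu_def)
next
  case False
  then obtain p where p: "prime p" "p dvd m"
    using prime_factor_nat by blast
  let ?A = "{d. d dvd m \<and> squarefree d \<and> \<not> p dvd d}"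
  let ?B = "{d. d dvd m \<and> squarefree d \<and> p dvd d}"
  have fin: "finite {d. d dvd m}"
    using assms by simp
  have B: "?B = (*) p ` ?A"
  proof (intro set_eqI iffI)
    fix x assume x: "x \<in> ?B"
    then obtain y where y: "x = p * y"
      by auto
    have "\<not> p dvd y"
    proof
      assume "p dvd y"
      then have "p ^ 2 dvd x"
        using y by (simp add: power2_eq_square)
      then have "is_unit p"
        using x by (auto simp: squarefree_def)
      then show False
        using p(1) by auto
    qed
    moreover have "squarefree y" "y dvd m"
      using x y squarefree_multD(2)[of p y] dvd_mult_right[of p y m] by simp_all
    ultimately show "x \<in> (*) p ` ?A"
      using y \<open>\<not> p dvd y\<close> by blast
  next
    fix x assume "x \<in> (*) p ` ?A"
    then obtain y where y: "x = p * y" "y dvd m" "squarefree y" "\<not> p dvd y"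
      by auto
    have cop: "coprime p y"
      using y p by (simp add: prime_imp_coprime)
    then have "x dvd m"
      using y p by (simp add: divides_mult)
    moreover have "squarefree x"
      using y cop p squarefree_mult_coprime squarefree_prime by blast
    ultimately show "x \<in> ?B"
      using y by simp
  qed
  have "(\<Sum>d | d dvd m. moebius_mu d) = sum moebius_mu (?A \<union> ?B)"
    by (rule sum.mono_neutral_right) (use fin in \<open>auto simp: moebius_mu_def\<close>)
  also have "\<dots> = sum moebius_mu ?A + sum moebius_mu ?B"
    by (rule sum.union_disjoint) (use fin in \<open>auto intro: finite_subset[OF _ fin]\<close>)
  also have "sum moebius_mu ?B = (\<Sum>d\<in>?A. moebius_mu (p * d))"
    unfolding B using p(1) by (subst sum.reindex) (auto simp: inj_on_def)
  also have "\<dots> = (\<Sum>d\<in>?A. - moebius_mu d)"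
    by (rule sum.cong) (use p(1) moebius_mu_prime_mult in auto)
  finally show ?thesis
    using False by (simp add: sum_negf)
qed

lemma dirichlet_conv_eq_sum_divisors:
  assumes "d > 0"
  shows "dirichlet_conv g h d = (\<Sum>b | b dvd d. g (d div b) * h b)"
  unfolding dirichlet_conv_def
  by (rule sum.reindex_bij_witness[of _ "\<lambda>b. (d div b, b)" snd])
     (use assms in \<open>auto elim!: dvdE intro: Nat.gr0I\<close>)

text \<open>
  Exchanging the sums, the coefficient of \<open>h b\<close> is the sum of \<open>\<mu>\<close> over the divisors of \<open>m / b\<close>, which
  is \<open>0\<close> unless \<open>b = m\<close>.
\<close>

lemma moebius_inversion:
  fixes h :: "nat \<Rightarrow> complex"
  assumes "m > 0"
  shows "(\<Sum>d | d dvd m. dirichlet_conv (\<lambda>a. of_int (moebius_mu a)) h d) = h m"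
proof -
  have fin: "finite {d. d dvd m}"
    using assms by simp
  have inner: "(\<Sum>d | d dvd m \<and> b dvd d. of_int (moebius_mu (d div b)) * h b)
      = (if b = m then h m else 0)" if b: "b dvd m" for b
  proof -
    obtain c where c: "m = b * c"
      using b by blast
    have pos: "b > 0" "c > 0"
      using c assms by auto
    have "(\<Sum>d | d dvd m \<and> b dvd d. of_int (moebius_mu (d div b)) * h b)
        = (\<Sum>a | a dvd c. of_int (moebius_mu a) * h b)"
      by (rule sum.reindex_bij_witness[of _ "\<lambda>a. b * a" "\<lambda>d. d div b"])
         (use c pos in auto)
    also have "\<dots> = of_int (\<Sum>a | a dvd c. moebius_mu a) * h b"
      by (simp add: sum_distrib_right)
    finally show ?thesis
      using sum_moebius_mu_divisors[OF pos(2)] c pos by auto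
  qed
  have "(\<Sum>d | d dvd m. dirichlet_conv (\<lambda>a. of_int (moebius_mu a)) h d)
      = (\<Sum>d\<in>{d. d dvd m}. \<Sum>b | b \<in> {b. b dvd m} \<and> b dvd d. of_int (moebius_mu (d div b)) * h b)"
  proof (rule sum.cong[OF refl])
    fix d assume d: "d \<in> {d. d dvd m}"
    then have "d > 0" "{b. b dvd d} = {b. b \<in> {b. b dvd m} \<and> b dvd d}"
      using assms dvd_pos_nat by (auto intro: dvd_trans)
    then show "dirichlet_conv (\<lambda>a. of_int (moebius_mu a)) h d
        = (\<Sum>b | b \<in> {b. b dvd m} \<and> b dvd d. of_int (moebius_mu (d div b)) * h b)"
      by (simp add: dirichlet_conv_eq_sum_divisors)
  qed
  also have "\<dots> = (\<Sum>b\<in>{b. b dvd m}. \<Sum>d | d \<in> {d. d dvd m} \<and> b dvd d.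
      of_int (moebius_mu (d div b)) * h b)"
    by (rule sum.swap_restrict[OF fin fin])
  also have "\<dots> = (\<Sum>b\<in>{b. b dvd m}. if b = m then h m else 0)"
    by (rule sum.cong) (simp_all add: inner)
  also have "\<dots> = h m"
    using fin by (simp add: sum.delta)
  finally show ?thesis .
qed

section \<open>Additive characters and periodic sums\<close>

lemma unit_exp_eq_cis: "unit_exp x = cis (2 * pi * x)"
  by (simp add: unit_exp_def cis_conv_exp mult_ac)

lemma unit_exp_add: "unit_exp (x + y) = unit_exp x * unit_exp y"
  by (simp add: unit_exp_eq_cis cis_mult distrib_left)

lemma unit_exp_eq_1_iff: "unit_exp x = 1 \<longleftrightarrow> x \<in> \<int>"
proof
  assume "unit_exp x = 1"
  then have "cos (2 * pi * x) = 1"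
    by (simp add: unit_exp_eq_cis complex_eq_iff)
  then obtain m :: int where "2 * pi * x = of_int m * 2 * pi"
    using cos_one_2pi_int by blast
  then have "x = of_int m"
    by simp
  then show "x \<in> \<int>"
    by simp
next
  assume "x \<in> \<int>"
  then show "unit_exp x = 1"
    by (auto simp: unit_exp_eq_cis elim!: Ints_cases)
qed

lemma unit_exp_fraction_eq_1_iff:
  assumes "n > 0"
  shows "unit_exp (real_of_int m / real n) = 1 \<longleftrightarrow> int n dvd m"
proof -
  have "real_of_int m / real n \<in> \<int> \<longleftrightarrow> int n dvd m"
  proof
    assume "real_of_int m / real n \<in> \<int>"
    then obtain j where "real_of_int m / real n = of_int j"
      by (auto elim: Ints_cases)
    then have "real_of_int m = real_of_int (int n * j)"
      using assms by (simp add: field_simps)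
    then show "int n dvd m"
      by (metis dvd_triv_left of_int_eq_iff)
  next
    assume "int n dvd m"
    then show "real_of_int m / real n \<in> \<int>"
      using assms by (auto elim!: dvdE)
  qed
  then show ?thesis
    by (simp add: unit_exp_eq_1_iff)
qed

lemma periodic_sum_shift:
  fixes G :: "int \<Rightarrow> 'a::ab_group_add"
  assumes per: "\<And>a. G (a + int n) = G a"
  shows "(\<Sum>a\<in>{1..int n}. G (a + t)) = (\<Sum>a\<in>{1..int n}. G a)"
proof -
  \<comment> \<open>A shift by one drops the term at \<open>1\<close> and gains the equal term at \<open>n + 1\<close>.\<close>
  have step: "(\<Sum>a\<in>{1..int n}. G (a + (u + 1))) = (\<Sum>a\<in>{1..int n}. G (a + u))" for u
  proof (cases "n = 0")
    case False
    have "(\<Sum>a\<in>{1..int n}. G (a + (u + 1))) = (\<Sum>a\<in>{2..int n + 1}. G (a + u))"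
      by (rule sum.reindex_bij_witness[of _ "\<lambda>a. a - 1" "\<lambda>a. a + 1"]) (auto simp: add_ac)
    also have "{2..int n + 1} = insert (int n + 1) {2..int n}"
      using False by auto
    also have "(\<Sum>a\<in>insert (int n + 1) {2..int n}. G (a + u))
        = G (int n + 1 + u) + (\<Sum>a\<in>{2..int n}. G (a + u))"
      by simp
    also have "G (int n + 1 + u) = G (1 + u)"
      using per[of "1 + u"] by (simp add: add_ac)
    also have "G (1 + u) + (\<Sum>a\<in>{2..int n}. G (a + u)) = (\<Sum>a\<in>insert 1 {2..int n}. G (a + u))"
      by simp
    also have "insert 1 {2..int n} = {1..int n}"
      using False by auto
    finally show ?thesis .
  qed simp
  show ?thesis
  proof (induction t rule: int_induct[where k = 0])
    case (step2 i)
    then show ?case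
      using step[of "i - 1"] by simp
  qed (simp_all add: step)
qed

text \<open>
  The indicator of the class has period \<open>n\<close>, so shifting by \<open>s\<close> reduces the count to the multiples of
  \<open>d\<close>.
\<close>

lemma card_residue_class:
  assumes "n = d * D" "n > 0"
  shows "card {a \<in> {1..int n}. int d dvd a - s} = D"
proof -
  have pos: "d > 0"
    using assms by (cases "d = 0") auto
  have "int (card {a \<in> {1..int n}. int d dvd a - s})
      = (\<Sum>a\<in>{1..int n}. if int d dvd a - s then 1 else 0)"
    by (simp add: sum.If_cases Int_def)
  also have "\<dots> = (\<Sum>a\<in>{1..int n}. if int d dvd (a + s) - s then 1 else 0)"
    by (rule periodic_sum_shift[symmetric])
       (metis add_diff_eq add.commute assms(1) dvd_add_right_iff dvd_triv_left of_nat_mult)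
  also have "\<dots> = int (card {a \<in> {1..int n}. int d dvd a})"
    by (simp add: sum.If_cases Int_def)
  also have "{a \<in> {1..int n}. int d dvd a} = (*) (int d) ` {1..int D}"
  proof (intro set_eqI iffI)
    fix a assume a: "a \<in> {a \<in> {1..int n}. int d dvd a}"
    then obtain j where j: "a = int d * j"
      by blast
    have "j \<ge> 1"
      using a j pos by (auto simp: zero_less_mult_iff int_one_le_iff_zero_less)
    moreover have "j \<le> int D"
      using a j pos assms(1) by simp
    ultimately show "a \<in> (*) (int d) ` {1..int D}"
      using j by auto
  next
    fix a assume "a \<in> (*) (int d) ` {1..int D}"
    then obtain j where "a = int d * j" "j \<in> {1..int D}"
      by blast
    then have j: "a = int d * j" "1 \<le> j" "j \<le> int D"
      by simp_all
    then have "0 < a"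
      using pos by simp
    then show "a \<in> {a \<in> {1..int n}. int d dvd a}"
      using j assms(1) by (auto simp: mult_left_mono)
  qed
  also have "card \<dots> = D"
    using pos by (subst card_image) (auto simp: inj_on_def)
  finally show ?thesis
    by simp
qed

section \<open>Exponential sums over reduced residues in a residue class\<close>

definition unit_class_sum :: "nat \<Rightarrow> int \<Rightarrow> int \<Rightarrow> nat \<Rightarrow> complex" where
  "unit_class_sum n k s d =
     (\<Sum>a | a \<in> {1..int n} \<and> gcd a (int n) = 1 \<and> int d dvd a - s.
        unit_exp (real_of_int (a * k) / real n))"

text \<open>
  Evenness gives \<open>f (a - s) = f m\<close> for \<open>m = gcd (a - s) n\<close>, and \<open>m\<close> is positive, so Moebius inversion
  applies at \<open>m\<close>; the divisors of \<open>m\<close> are the divisors \<open>d\<close> of \<open>n\<close> with \<open>a\<close> in the class of \<open>s\<close>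
  modulo \<open>d\<close>.
\<close>

lemma S_sum_eq_sum_over_divisors:
  assumes "n > 0" "even_function_mod n f"
  shows "S_sum f n k s =
    (\<Sum>d | d dvd n. dirichlet_conv (\<lambda>a. of_int (moebius_mu a)) (\<lambda>b. f (int b)) d
       * unit_class_sum n k s d)"
proof -
  let ?g = "dirichlet_conv (\<lambda>a. of_int (moebius_mu a)) (\<lambda>b. f (int b))"
  let ?A = "{a. a \<in> {1..int n} \<and> gcd a (int n) = 1}"
  let ?e = "\<lambda>a. unit_exp (real_of_int (a * k) / real n)"
  have f: "f (a - s) = (\<Sum>d | d \<in> {d. d dvd n} \<and> int d dvd a - s. ?g d)" for a
  proof -
    define m where "m = nat (gcd (a - s) (int n))"
    have m: "int m = gcd (a - s) (int n)"
      by (simp add: m_def)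
    have "m > 0"
      using assms(1) by (simp add: m_def)
    have "d dvd m \<longleftrightarrow> d dvd n \<and> int d dvd a - s" for d
    proof -
      have "d dvd m \<longleftrightarrow> int d dvd int m"
        by simp
      also have "\<dots> \<longleftrightarrow> d dvd n \<and> int d dvd a - s"
        unfolding m by auto
      finally show ?thesis .
    qed
    then have "(\<Sum>d | d \<in> {d. d dvd n} \<and> int d dvd a - s. ?g d) = (\<Sum>d | d dvd m. ?g d)"
      by simp
    also have "\<dots> = f (int m)"
      using \<open>m > 0\<close> by (rule moebius_inversion)
    also have "\<dots> = f (a - s)"
      using assms(2) by (simp add: m even_function_mod_def)
    finally show ?thesis
      by simp
  qed
  have "finite ?A"
    by (rule finite_subset[of _ "{1..int n}"]) auto
  have "S_sum f n k s = (\<Sum>a\<in>?A. \<Sum>d | d \<in> {d. d dvd n} \<and> int d dvd a - s. ?g d * ?e a)"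
    unfolding S_sum_def f sum_distrib_right ..
  also have "\<dots> = (\<Sum>d\<in>{d. d dvd n}. \<Sum>a | a \<in> ?A \<and> int d dvd a - s. ?g d * ?e a)"
    by (rule sum.swap_restrict) (use \<open>finite ?A\<close> assms(1) in auto)
  also have "\<dots> = (\<Sum>d | d dvd n. ?g d * unit_class_sum n k s d)"
    by (simp add: unit_class_sum_def sum_distrib_left conj_assoc)
  finally show ?thesis .
qed

lemma unit_class_sum_not_coprime:
  assumes "d dvd n" "gcd (int d) s \<noteq> 1"
  shows "unit_class_sum n k s d = 0"
proof -
  have "\<not> coprime a (int n)" if "int d dvd a - s" for a
  proof
    assume "coprime a (int n)"
    have "gcd (int d) s dvd (a - s) + s"
      using that by (meson dvd_add dvd_trans gcd_dvd1 gcd_dvd2)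
    moreover have "gcd (int d) s dvd int n"
      using assms(1) by (meson dvd_trans gcd_dvd1 of_nat_dvd_iff)
    ultimately have "gcd (int d) s dvd gcd a (int n)"
      by simp
    then show False
      using assms(2) \<open>coprime a (int n)\<close> by simp
  qed
  then have "{a. a \<in> {1..int n} \<and> gcd a (int n) = 1 \<and> int d dvd a - s} = {}"
    by auto
  then show ?thesis
    unfolding unit_class_sum_def by (metis sum.empty)
qed

lemma padic_val_ge_iff:
  assumes "prime p"
  shows "enat j \<le> padic_val p m \<longleftrightarrow> int p ^ j dvd m"
proof (cases "m = 0")
  case False
  have "\<not> is_unit (int p)"
    using assms by (simp add: prime_nat_iff)
  then show ?thesis
    using False by (simp add: padic_val_def power_dvd_iff_le_multiplicity)
qed (simp add: padic_val_def)

lemma power_Suc_multiplicity_not_dvd: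
  fixes p :: nat and k :: int
  assumes "prime p" "k \<noteq> 0"
  shows "\<not> int p ^ Suc (multiplicity (int p) k) dvd k"
proof -
  have "\<not> is_unit (int p)"
    using assms(1) by (simp add: prime_nat_iff)
  then show ?thesis
    using assms(2) by (simp add: power_dvd_iff_le_multiplicity del: power_Suc)
qed

text \<open>
  Since \<open>n\<close> divides \<open>d * k\<close>, the factors \<open>p\<close> that \<open>n\<close> has in excess of \<open>k\<close> must come from \<open>d\<close>.
\<close>

lemma prime_dvd_class_modulus:
  assumes "prime p" "p dvd n" "n > 0" "int n dvd int d * k"
    and val: "padic_val p (int n) \<ge> padic_val p k + 2"
  shows "p dvd d"
proof -
  have k: "k \<noteq> 0"
    using val assms(3) by (auto simp: padic_val_def)
  define v where "v = multiplicity (int p) k"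
  have "enat (v + 2) \<le> padic_val p (int n)"
    using val k by (simp add: padic_val_def v_def numeral_eq_enat)
  then have "int p ^ (v + 2) dvd int n"
    using padic_val_ge_iff assms(1) by blast
  then have "int p ^ (v + 2) dvd int d * k"
    using assms(4) dvd_trans by blast
  moreover have "\<not> int p ^ Suc v dvd k"
    unfolding v_def using assms(1) k by (rule power_Suc_multiplicity_not_dvd)
  ultimately have "\<not> coprime (int p ^ (v + 2)) (int d)"
    by (metis add_2_eq_Suc' coprime_dvd_mult_right_iff dvd_trans le_imp_power_dvd lessI less_imp_le)
  then show "p dvd d"
    using assms(1) by (metis coprime_power_left_iff of_nat_dvd_iff prime_imp_coprime prime_nat_int_transfer)
qed

lemma coprime_via_prime_factors:
  fixes a :: int
  assumes "n > 0" "\<And>p::nat. prime p \<Longrightarrow> p dvd n \<Longrightarrow> \<not> int p dvd a"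
  shows "gcd a (int n) = 1"
proof (rule ccontr)
  assume "gcd a (int n) \<noteq> 1"
  then have "nat (gcd a (int n)) \<noteq> 1"
    by (metis gcd_ge_0_int nat_0_le of_nat_1)
  then obtain p where p: "prime p" "p dvd nat (gcd a (int n))"
    using prime_factor_nat by blast
  then have "int p dvd int (nat (gcd a (int n)))"
    by (simp only: int_dvd_int_iff)
  then have "int p dvd gcd a (int n)"
    by simp
  then show False
    using assms(2)[OF p(1)] by simp
qed

text \<open>
  The condition of being prime to \<open>n\<close> is automatic here: a prime factor of \<open>n\<close> dividing \<open>a\<close> would
  divide \<open>d\<close>, hence also \<open>s\<close>. As \<open>n\<close> divides \<open>(a - s) * k\<close>, each \<open>a\<close> contributes the same term as
  \<open>s\<close>.
\<close>

lemma unit_class_sum_constant: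
  assumes "n = d * D" "n > 0" "gcd (int d) s = 1" "int n dvd int d * k"
    and primes: "\<And>p::nat. prime p \<Longrightarrow> p dvd n \<Longrightarrow> p dvd d"
  shows "unit_class_sum n k s d = of_nat D * unit_exp (real_of_int (k * s) / real n)"
proof -
  have cop: "gcd a (int n) = 1" if a: "int d dvd a - s" for a
  proof (rule coprime_via_prime_factors[OF assms(2)])
    fix p :: nat
    assume p: "prime p" "p dvd n"
    then have pd: "int p dvd int d"
      using primes by simp
    show "\<not> int p dvd a"
    proof
      assume "int p dvd a"
      then have "int p dvd a - (a - s)"
        using dvd_trans[OF pd a] dvd_diff by blast
      then have "int p dvd gcd (int d) s"
        using pd by simp
      then show False
        using assms(3) p(1) by (simp add: prime_nat_iff)
    qed
  qed
  have const: "unit_exp (real_of_int (a * k) / real n) = unit_exp (real_of_int (k * s) / real n)"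
    if a: "int d dvd a - s" for a
  proof -
    have "int d * k dvd (a - s) * k"
      using a by simp
    then have "int n dvd (a - s) * k"
      using assms(4) dvd_trans by blast
    then have 1: "unit_exp (real_of_int ((a - s) * k) / real n) = 1"
      using assms(2) unit_exp_fraction_eq_1_iff by blast
    have "real_of_int (a * k) / real n
        = real_of_int (k * s) / real n + real_of_int ((a - s) * k) / real n"
      by (simp add: add_divide_distrib[symmetric] algebra_simps)
    then show ?thesis
      using 1 by (simp only: unit_exp_add mult_1_right)
  qed
  have "unit_class_sum n k s d
      = (\<Sum>a\<in>{a \<in> {1..int n}. int d dvd a - s}. unit_exp (real_of_int (k * s) / real n))"
    unfolding unit_class_sum_def by (rule sum.cong) (use cop const in auto)
  then show ?thesis
    using card_residue_class[OF assms(1,2), of s] by simp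
qed

text \<open>
  Translation by \<open>t\<close> preserves the class modulo \<open>d\<close>, and also the reduced residues, because being
  prime to \<open>n\<close> depends only on the residues modulo the primes dividing \<open>n\<close>.
\<close>

lemma unit_class_sum_shift:
  assumes "n > 0" "d dvd n" "int d dvd t"
    and primes: "\<And>p::nat. prime p \<Longrightarrow> p dvd n \<Longrightarrow> int p dvd t"
  shows "unit_class_sum n k s d
    = unit_exp (real_of_int (t * k) / real n) * unit_class_sum n k s d"
proof -
  let ?e = "\<lambda>a. unit_exp (real_of_int (a * k) / real n)"
  let ?P = "\<lambda>a. gcd a (int n) = 1 \<and> int d dvd a - s"
  define G where "G a = (if ?P a then ?e a else 0)" for a
  have e_add: "?e (a + b) = ?e a * ?e b" for a b
    by (simp add: unit_exp_add[symmetric] distrib_right add_divide_distrib)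
  have class_inv: "int d dvd a + u - s \<longleftrightarrow> int d dvd a - s" if "int d dvd u" for a u
  proof -
    have "a + u - s = (a - s) + u" by simp
    then show ?thesis
      using that by (metis dvd_add_left_iff)
  qed
  have cop_inv: "gcd (a + t) (int n) = 1 \<longleftrightarrow> gcd a (int n) = 1" for a
  proof
    assume *: "gcd (a + t) (int n) = 1"
    show "gcd a (int n) = 1"
    proof (rule coprime_via_prime_factors[OF assms(1)])
      fix p :: nat assume p: "prime p" "p dvd n"
      show "\<not> int p dvd a"
      proof
        assume "int p dvd a"
        then have "int p dvd gcd (a + t) (int n)"
          using p primes by simp
        then show False
          using * p(1) by (simp add: prime_nat_iff)
      qed
    qed
  next
    assume *: "gcd a (int n) = 1"
    show "gcd (a + t) (int n) = 1"
    proof (rule coprime_via_prime_factors[OF assms(1)])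
      fix p :: nat assume p: "prime p" "p dvd n"
      show "\<not> int p dvd a + t"
      proof
        assume "int p dvd a + t"
        then have "int p dvd gcd a (int n)"
          using p primes by (simp add: dvd_add_left_iff)
        then show False
          using * p(1) by (simp add: prime_nat_iff)
      qed
    qed
  qed
  have G: "unit_class_sum n k s d = (\<Sum>a\<in>{1..int n}. G a)"
    unfolding unit_class_sum_def G_def
    by (simp add: sum.If_cases Int_def Collect_conj_eq[symmetric] conj_assoc)
  have "?e (int n) = 1"
    using assms(1) unit_exp_fraction_eq_1_iff[of n "int n * k"] by simp
  then have "G (a + int n) = G a" for a
    using assms(2) class_inv[of "int n" a] unfolding G_def e_add by simp
  then have "(\<Sum>a\<in>{1..int n}. G a) = (\<Sum>a\<in>{1..int n}. G (a + t))"
    by (rule periodic_sum_shift[symmetric])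
  also have "\<dots> = (\<Sum>a\<in>{1..int n}. ?e t * G a)"
    using class_inv[OF assms(3)] cop_inv unfolding G_def e_add
    by (intro sum.cong) auto
  also have "\<dots> = ?e t * (\<Sum>a\<in>{1..int n}. G a)"
    by (rule sum_distrib_left[symmetric])
  finally show ?thesis
    unfolding G .
qed

text \<open>
  A suitable shift multiplies the sum by a factor different from \<open>1\<close>. As \<open>D\<close> does not divide \<open>k\<close>,
  some prime \<open>p\<close> occurs in \<open>D\<close> at least \<open>v + 1\<close> times, where \<open>v = \<nu>\<^sub>p(k)\<close>; the shift
  \<open>t = n / p ^ (v + 1)\<close> is therefore a multiple of \<open>d\<close>, and \<open>n\<close> does not divide \<open>t * k\<close>. The hypothesis on
  valuations serves to leave a factor \<open>p\<close> in \<open>t\<close>, so that the shift preserves the reduced residues.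
\<close>

lemma unit_class_sum_vanishes:
  assumes "n > 0" "n = d * D" "\<not> int D dvd k"
    and val: "\<And>p::nat. prime p \<Longrightarrow> p dvd n \<Longrightarrow> padic_val p (int n) \<ge> padic_val p k + 2"
  shows "unit_class_sum n k s d = 0"
proof -
  have k: "k \<noteq> 0"
    using assms(3) by auto
  have D: "D > 0"
    using assms(1,2) by auto
  have "\<exists>p. prime p \<and> multiplicity p (int D) > multiplicity p k"
  proof (rule ccontr)
    assume "\<not> ?thesis"
    then have "int D dvd k"
      using D k by (intro multiplicity_le_imp_dvd) (auto simp: not_less)
    then show False
      using assms(3) by blast
  qed
  then obtain p' :: int where p': "prime p'" "multiplicity p' (int D) > multiplicity p' k"
    by blast
  define p where "p = nat p'"
  have p'_eq: "p' = int p"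
    using p'(1) prime_ge_0_int by (simp add: p_def)
  have p: "prime p"
    using p'(1) p'_eq by simp
  define v where "v = multiplicity (int p) k"
  have "int p ^ Suc v dvd int D"
    using p'(2) unfolding p'_eq v_def by (intro multiplicity_dvd') simp
  then have "p ^ Suc v dvd D"
    by (metis of_nat_dvd_iff of_nat_power)
  then obtain c where c: "D = p ^ Suc v * c"
    by blast
  define t where "t = d * c"
  have n: "n = p ^ Suc v * t"
    by (simp add: assms(2) c t_def)
  have notdvd: "\<not> int p ^ Suc v dvd k"
    unfolding v_def using p k by (rule power_Suc_multiplicity_not_dvd)
  have t: "t > 0"
    using n assms(1) by (cases "t = 0") auto
  have "p dvd t"
  proof -
    have "p dvd n"
      using n by simp
    then have "enat (Suc v + 1) \<le> padic_val p (int n)"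
      using val[OF p] k by (simp add: padic_val_def v_def numeral_eq_enat)
    then have "int p ^ (Suc v + 1) dvd int n"
      using padic_val_ge_iff p by blast
    then have "p ^ (Suc v + 1) dvd p ^ Suc v * t"
      by (metis n of_nat_dvd_iff of_nat_power)
    then show ?thesis
      using p by (simp add: prime_gt_0_nat)
  qed
  then have primes: "int q dvd int t" if "prime q" "q dvd n" for q
    using that n p
    by (metis of_nat_dvd_iff prime_dvd_mult_iff prime_dvd_power primes_dvd_imp_eq)
  have "int d dvd int t"
    by (simp add: t_def)
  moreover have "\<not> int n dvd int t * k"
    using notdvd t unfolding n by (simp add: mult.commute[of _ "int t"] del: power_Suc)
  then have "unit_exp (real_of_int (int t * k) / real n) \<noteq> 1"
    using assms(1) unit_exp_fraction_eq_1_iff by blast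
  ultimately show ?thesis
    using unit_class_sum_shift[OF assms(1) _ _ primes, of d k s] assms(2) by auto
qed

section \<open>The evaluation\<close>

theorem theorem3p2:
  fixes n :: nat and k s :: int and f :: "int \<Rightarrow> complex"
  assumes "n \<ge> 1"
    and "even_function_mod n f"
    and "\<And>p::nat. prime p \<Longrightarrow> p dvd n \<Longrightarrow> padic_val p (int n) \<ge> padic_val p k + 2"
  shows "S_sum f n k s =
    unit_exp (real_of_int (k * s) / real n) *
    (\<Sum>d | int d dvd gcd (int n) k \<and> gcd (int (n div d)) s = 1.
       of_nat d * dirichlet_conv (\<lambda>a. of_int (moebius_mu a)) (\<lambda>b. f (int b)) (n div d))"
proof -
  let ?g = "dirichlet_conv (\<lambda>a. of_int (moebius_mu a)) (\<lambda>b. f (int b))"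
  let ?e = "unit_exp (real_of_int (k * s) / real n)"
  let ?S = "{d. int d dvd gcd (int n) k \<and> gcd (int (n div d)) s = 1}"
  have n: "n > 0"
    using assms(1) by simp
  have fin: "finite {d. d dvd n}"
    using n by simp
  have eval: "unit_class_sum n k s (n div d) = (if d \<in> ?S then of_nat d * ?e else 0)"
    if d: "d dvd n" for d
  proof -
    have nd: "n = (n div d) * d"
      using d by simp
    consider "gcd (int (n div d)) s \<noteq> 1" | "\<not> int d dvd k"
      | "gcd (int (n div d)) s = 1" "int d dvd k"
      by argo
    then show ?thesis
    proof cases
      case 1
      then show ?thesis
        using unit_class_sum_not_coprime[OF dvdI[OF nd], of s k] by simp
    next
      case 2
      then show ?thesis
        using unit_class_sum_vanishes[OF n nd 2 assms(3)] by simp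
    next
      case 3
      have "int (n div d) * int d dvd int (n div d) * k"
        using 3(2) by (rule mult_dvd_mono[OF dvd_refl])
      then have dvd: "int n dvd int (n div d) * k"
        using nd by (metis of_nat_mult)
      have "p dvd n div d" if "prime p" "p dvd n" for p
        using prime_dvd_class_modulus[OF that n dvd] assms(3)[OF that] by blast
      then show ?thesis
        using unit_class_sum_constant[OF nd n 3(1) dvd] 3 d by simp
    qed
  qed
  have "S_sum f n k s = (\<Sum>d | d dvd n. ?g d * unit_class_sum n k s d)"
    by (rule S_sum_eq_sum_over_divisors[OF n assms(2)])
  also have "\<dots> = (\<Sum>d | d dvd n. ?g (n div d) * unit_class_sum n k s (n div d))"
    by (rule sum.reindex_bij_witness[of _ "\<lambda>d. n div d" "\<lambda>d. n div d"])
       (use n in \<open>auto elim!: dvdE\<close>)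
  also have "\<dots> = (\<Sum>d | d dvd n. if d \<in> ?S then ?e * (of_nat d * ?g (n div d)) else 0)"
    by (rule sum.cong) (auto simp: eval)
  also have "\<dots> = (\<Sum>d\<in>?S. ?e * (of_nat d * ?g (n div d)))"
  proof (rule sum.mono_neutral_cong_right[OF fin])
    show "?S \<subseteq> {d. d dvd n}"
      by auto
  qed auto
  finally show ?thesis
    by (simp only: sum_distrib_left)
qed

end
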